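(* Let $(X,d)$ be a compact metric space, let $\mathcal{H}$ be a Hilbert space, and let $P(X)$ be the collection of all projection-valued measures from the Borel subsets $\mathcal{B}(X)$ of $X$ into the projections on $\mathcal{H}$, equipped with the metric $$\rho(E,F)=\sup_{\phi\in \mathrm{Lip}_1(X)}\left\|\int\phi\,dE-\int\phi\,dF\right\|,$$ where $\|\cdot\|$ is the operator norm on $\mathcal{B}(\mathcal{H})$. Then the metric space $(P(X),\rho)$ is bounded.
   Context: $\mathcal{B}(\mathcal{H})$ denotes the bounded operators on the (complex) Hilbert space $\mathcal{H}$. A projection-valued measure $F:\mathcal{B}(X)\to\mathcal{B}(\mathcal{H})$ assigns to each Borel set an orthogonal projection, with $F(\emptyset)=0$, $F(X)=\mathrm{id}_{\mathcal{H}}$, $F(\Delta_1\cap\Delta_2)=F(\Delta_1)F(\Delta_2)$, and countable additivity (in the strong operator topology) on disjoint sequences of Borel sets. For $g,h\in\mathcal{H}$, $F_{g,h}(\Delta)=\langle F(\Delta)g,h\rangle$ is a countably additive complex measure. For a bounded Borel function $\psi:X\to\mathbb{C}$, $\int\psi\,dF$ is the unique bounded operator with $\langle(\int\psi\,dF)g,h\rangle=\int_X\psi\,dF_{g,h}$ for all $g,h\in\mathcal{H}$. $\mathrm{Lip}_1(X)=\{\phi:X\to\mathbb{R}: |\phi(x)-\phi(y)|\le d(x,y)\text{ for all }x,y\in X\}$. *)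

theory Defs
  imports "HOL-Analysis.Analysis"
begin

section \<open>Complex Hilbert spaces and their bounded operators\<close>

text \<open>The inner product is linear in its first argument. The axiom \<open>cinner_self\<close> says at once
  that the inner product is positive definite and that it induces the norm.\<close>

class chilbert_space = banach +
  fixes scaleC :: "complex \<Rightarrow> 'a \<Rightarrow> 'a"
    and cinner :: "'a \<Rightarrow> 'a \<Rightarrow> complex"
  assumes scaleC_add_right: "scaleC a (x + y) = scaleC a x + scaleC a y"
    and scaleC_add_left: "scaleC (a + b) x = scaleC a x + scaleC b x"
    and scaleC_scaleC: "scaleC a (scaleC b x) = scaleC (a * b) x"
    and scaleR_scaleC: "scaleR r x = scaleC (complex_of_real r) x"
    and cinner_commute: "cinner x y = cnj (cinner y x)"
    and cinner_add_left: "cinner (x + y) z = cinner x z + cinner y z"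
    and cinner_scaleC_left: "cinner (scaleC a x) y = a * cinner x y"
    and cinner_self: "cinner x x = complex_of_real ((norm x)\<^sup>2)"

text \<open>The type \<open>'h \<Rightarrow>\<^sub>L 'h\<close> contains all bounded real-linear maps, so complex homogeneity has to be
  required. Its norm is the operator norm.\<close>

definition bounded_ops :: "('h::chilbert_space \<Rightarrow>\<^sub>L 'h) set" where
  "bounded_ops = {T. \<forall>c x. blinfun_apply T (scaleC c x) = scaleC c (blinfun_apply T x)}"

definition orth_projections :: "('h::chilbert_space \<Rightarrow>\<^sub>L 'h) set" where
  "orth_projections = {T \<in> bounded_ops. T o\<^sub>L T = T \<and>
     (\<forall>x y. cinner (blinfun_apply T x) y = cinner x (blinfun_apply T y))}"


section \<open>Integration with respect to a complex measure\<close>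

text \<open>A signed or complex measure on the measurable space \<open>M\<close> is a countably additive function on
  \<open>sets M\<close>; the measure carried by \<open>M\<close> itself plays no role. The positive variation of a signed
  measure \<open>\<nu>\<close> is \<open>\<nu>\<^sup>+(A) = sup {\<nu>(B) | B \<subseteq> A measurable}\<close>, its negative variation is \<open>(-\<nu>)\<^sup>+\<close>, and
  \<open>\<nu> = \<nu>\<^sup>+ - (-\<nu>)\<^sup>+\<close> is the Jordan decomposition.\<close>

definition pos_variation :: "'a measure \<Rightarrow> ('a set \<Rightarrow> real) \<Rightarrow> 'a measure" where
  "pos_variation M \<nu> =
     measure_of (space M) (sets M) (\<lambda>A. ennreal (SUP B\<in>{B \<in> sets M. B \<subseteq> A}. \<nu> B))"

definition signed_integral :: "'a measure \<Rightarrow> ('a set \<Rightarrow> real) \<Rightarrow> ('a \<Rightarrow> complex) \<Rightarrow> complex" where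
  "signed_integral M \<nu> \<psi> =
     integral\<^sup>L (pos_variation M \<nu>) \<psi> - integral\<^sup>L (pos_variation M (\<lambda>A. - \<nu> A)) \<psi>"

definition complex_measure_integral ::
  "'a measure \<Rightarrow> ('a set \<Rightarrow> complex) \<Rightarrow> ('a \<Rightarrow> complex) \<Rightarrow> complex" where
  "complex_measure_integral M \<mu> \<psi> =
     signed_integral M (\<lambda>A. Re (\<mu> A)) \<psi> + \<i> * signed_integral M (\<lambda>A. Im (\<mu> A)) \<psi>"


section \<open>Projection-valued measures\<close>

text \<open>The metric space is a subset \<open>X\<close> of a metric type, and \<open>borel_on X\<close> is its Borel
  \<open>\<sigma>\<close>-algebra.\<close>

abbreviation borel_on :: "'a::metric_space set \<Rightarrow> 'a measure" where
  "borel_on X \<equiv> restrict_space borel X"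

text \<open>The extensional function space makes two projection-valued measures equal as soon as they
  agree on the Borel subsets of \<open>X\<close>.\<close>

definition pvms :: "'a::metric_space set \<Rightarrow> ('a set \<Rightarrow> 'h::chilbert_space \<Rightarrow>\<^sub>L 'h) set" where
  "pvms X = {F \<in> sets (borel_on X) \<rightarrow>\<^sub>E orth_projections.
     F {} = 0 \<and> F X = id_blinfun \<and>
     (\<forall>A\<in>sets (borel_on X). \<forall>B\<in>sets (borel_on X). F (A \<inter> B) = F A o\<^sub>L F B) \<and>
     (\<forall>A :: nat \<Rightarrow> 'a set. range A \<subseteq> sets (borel_on X) \<longrightarrow> disjoint_family A \<longrightarrow>
        (\<forall>g. (\<lambda>n. blinfun_apply (F (A n)) g) sums blinfun_apply (F (\<Union>n. A n)) g))}"

definition pvm_integral ::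
  "'a::metric_space set \<Rightarrow> ('a set \<Rightarrow> 'h::chilbert_space \<Rightarrow>\<^sub>L 'h) \<Rightarrow> ('a \<Rightarrow> complex) \<Rightarrow> 'h \<Rightarrow>\<^sub>L 'h" where
  "pvm_integral X F \<psi> = (THE T. T \<in> bounded_ops \<and>
     (\<forall>g h. cinner (blinfun_apply T g) h =
        complex_measure_integral (borel_on X) (\<lambda>A. cinner (blinfun_apply (F A) g) h) \<psi>))"

text \<open>The values of \<open>\<phi>\<close> outside \<open>X\<close> influence neither membership in \<open>Lip1 X\<close> nor the integrals.\<close>

definition Lip1 :: "'a::metric_space set \<Rightarrow> ('a \<Rightarrow> real) set" where
  "Lip1 X = {\<phi>. 1-lipschitz_on X \<phi>}"

definition pvm_diffs :: "'a::metric_space set \<Rightarrow> ('a set \<Rightarrow> 'h::chilbert_space \<Rightarrow>\<^sub>L 'h) \<Rightarrow>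
    ('a set \<Rightarrow> 'h \<Rightarrow>\<^sub>L 'h) \<Rightarrow> real set" where
  "pvm_diffs X E F =
     (\<lambda>\<phi>. norm (pvm_integral X E (\<lambda>x. complex_of_real (\<phi> x)) -
                 pvm_integral X F (\<lambda>x. complex_of_real (\<phi> x)))) ` Lip1 X"

text \<open>The locale \<open>Metric_space\<close> asks for a nonnegative distance even outside the carrier, where
  the supremum need not make sense; hence the value \<open>0\<close> there. On the carrier, the real
  supremum is meaningful only if \<open>pvm_diffs X E F\<close> is bounded above.\<close>

definition pvm_dist :: "'a::metric_space set \<Rightarrow> ('a set \<Rightarrow> 'h::chilbert_space \<Rightarrow>\<^sub>L 'h) \<Rightarrow>
    ('a set \<Rightarrow> 'h \<Rightarrow>\<^sub>L 'h) \<Rightarrow> real" where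
  "pvm_dist X E F = (if E \<in> pvms X \<and> F \<in> pvms X then Sup (pvm_diffs X E F) else 0)"

end

theory Submission
  imports Defs
begin

text \<open>A real function \<open>f\<close> with values in \<open>[0, 1)\<close> is the sum of \<open>2^-(k+1)\<close> times the indicator functions
  of the sets \<open>A k\<close> on which the \<open>k\<close>-th binary digit of \<open>f\<close> is \<open>1\<close>. Hence \<open>\<integral>f dF\<close> is the norm-convergent
  series of the \<open>2^-(k+1) F(A k)\<close>, which has norm at most \<open>1\<close>. Adding a constant to \<open>\<phi>\<close> adds the same
  multiple of the identity to \<open>\<integral>\<phi> dE\<close> and to \<open>\<integral>\<phi> dF\<close>, and a \<open>1\<close>-Lipschitz \<open>\<phi>\<close> varies by at most the
  diameter on each side of any of its values, so \<open>\<rho>(E, F)\<close> is bounded by a multiple of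
  \<open>2 diam X + 1\<close>; the \<open>1\<close> makes room for the half-open interval. By polarization everything reduces
  to the positive measures \<open>\<langle>F(\<Delta>)g, g\<rangle>\<close>. They are determined by the integrals of Lipschitz functions,
  because \<open>n max (0, 1/n - d(x, C))\<close> tends to the indicator function of \<open>C\<close> for closed \<open>C\<close>; hence
  \<open>\<rho>\<close> separates points.\<close>

subsection \<open>Integration against a difference of finite measures\<close>

text \<open>The balance \<open>p - q = a - b\<close> is written with sums only, since subtraction is
  badly behaved in \<open>ennreal\<close>. It extends from indicators to all measurable functions
  because both sides are additive and continuous along increasing sequences.\<close>

lemma nn_integral_add_eq_add:
  assumes [measurable_cong]: "sets p = sets M" "sets q = sets M" "sets a = sets M" "sets b = sets M"
    and eq: "\<And>A. A \<in> sets M \<Longrightarrow> emeasure p A + emeasure b A = emeasure a A + emeasure q A"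
    and f: "f \<in> borel_measurable M"
  shows "nn_integral p f + nn_integral b f = nn_integral a f + nn_integral q f"
  using f
proof (induction rule: borel_measurable_induct)
  case (cong f g)
  have "space p = space M" "space q = space M" "space a = space M" "space b = space M"
    using assms(1-4)[THEN sets_eq_imp_space_eq] by auto
  then have "nn_integral N f = nn_integral N g" if "N \<in> {p, q, a, b}" for N
    using that cong(3) by (intro nn_integral_cong) auto
  with cong show ?case by auto
next
  case (set A)
  with assms show ?case by simp
next
  case (mult u c)
  then show ?case by (simp add: nn_integral_cmult distrib_left[symmetric])
next
  case (add u v)
  have "nn_integral N (\<lambda>x. v x + u x) = nn_integral N v + nn_integral N u"
    if "sets N = sets M" for N
    using add(1,3) that by (intro nn_integral_add) (auto cong: measurable_cong_sets)
  then have *: "nn_integral N (\<lambda>x. v x + u x) = nn_integral N v + nn_integral N u"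
    if "N \<in> {p, q, a, b}" for N
    using that assms by auto
  have "nn_integral p (\<lambda>x. v x + u x) + nn_integral b (\<lambda>x. v x + u x)
      = (nn_integral p v + nn_integral b v) + (nn_integral p u + nn_integral b u)"
    using * by (simp add: ac_simps)
  also have "\<dots> = nn_integral a (\<lambda>x. v x + u x) + nn_integral q (\<lambda>x. v x + u x)"
    unfolding add using * by (simp add: ac_simps)
  finally show ?case .
next
  case (seq U)
  have S: "nn_integral N (SUP i. U i) = (SUP i. nn_integral N (U i))"
    if "N \<in> {p, q, a, b}" for N
  proof -
    have "U i \<in> borel_measurable N" for i
      using seq(1)[of i] that assms by (auto cong: measurable_cong_sets)
    moreover have "(SUP i. U i) = (\<lambda>x. SUP i. U i x)"
      by (rule ext) (simp only: SUP_apply)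
    ultimately show ?thesis
      using nn_integral_monotone_convergence_SUP[OF seq(3)] by simp
  qed
  have I: "incseq (\<lambda>i. nn_integral N (U i))" for N
    using seq(3) by (auto simp: incseq_def le_fun_def intro!: nn_integral_mono)
  have "nn_integral p (SUP i. U i) + nn_integral b (SUP i. U i)
      = (SUP i. nn_integral p (U i) + nn_integral b (U i))"
    by (simp add: S ennreal_SUP_add[OF I I])
  also have "\<dots> = nn_integral a (SUP i. U i) + nn_integral q (SUP i. U i)"
    unfolding seq.IH by (simp add: S ennreal_SUP_add[OF I I])
  finally show ?case .
qed

lemma integrable_bounded:
  fixes f :: "'a \<Rightarrow> real"
  assumes "finite_measure N" "sets N = sets M" "f \<in> borel_measurable M"
    "\<And>x. x \<in> space M \<Longrightarrow> \<bar>f x\<bar> \<le> C"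
  shows "integrable N f"
proof -
  interpret finite_measure N by fact
  have "f \<in> borel_measurable N"
    using assms(2,3) by (simp cong: measurable_cong_sets)
  then show ?thesis
    using assms sets_eq_imp_space_eq[OF assms(2)]
    by (intro integrable_const_bound[where B=C]) auto
qed

text \<open>Positive and negative parts are treated separately; integrability makes all the
  integrals involved finite, so \<open>enn2real\<close> is additive on them.\<close>

lemma integral_add_eq_add:
  fixes f :: "'a \<Rightarrow> real"
  assumes sets: "sets p = sets M" "sets q = sets M" "sets a = sets M" "sets b = sets M"
    and eq: "\<And>A. A \<in> sets M \<Longrightarrow> emeasure p A + emeasure b A = emeasure a A + emeasure q A"
    and int: "integrable p f" "integrable q f" "integrable a f" "integrable b f"
  shows "integral\<^sup>L p f + integral\<^sup>L b f = integral\<^sup>L a f + integral\<^sup>L q f"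
proof -
  have [measurable]: "f \<in> borel_measurable M"
    using borel_measurable_integrable[OF int(1)] sets by (simp cong: measurable_cong_sets)
  have 1: "nn_integral p (\<lambda>x. ennreal (f x)) + nn_integral b (\<lambda>x. ennreal (f x))
      = nn_integral a (\<lambda>x. ennreal (f x)) + nn_integral q (\<lambda>x. ennreal (f x))"
    using sets eq by (rule nn_integral_add_eq_add) simp_all
  have 2: "nn_integral p (\<lambda>x. ennreal (- f x)) + nn_integral b (\<lambda>x. ennreal (- f x))
      = nn_integral a (\<lambda>x. ennreal (- f x)) + nn_integral q (\<lambda>x. ennreal (- f x))"
    using sets eq by (rule nn_integral_add_eq_add) simp_all
  note fin = int[unfolded real_integrable_def]
  have "enn2real (nn_integral p (\<lambda>x. ennreal (f x))) + enn2real (nn_integral b (\<lambda>x. ennreal (f x)))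
      = enn2real (nn_integral a (\<lambda>x. ennreal (f x))) + enn2real (nn_integral q (\<lambda>x. ennreal (f x)))"
    using arg_cong[OF 1, of enn2real] fin by (simp add: enn2real_plus less_top)
  moreover have "enn2real (nn_integral p (\<lambda>x. ennreal (- f x))) + enn2real (nn_integral b (\<lambda>x. ennreal (- f x)))
      = enn2real (nn_integral a (\<lambda>x. ennreal (- f x))) + enn2real (nn_integral q (\<lambda>x. ennreal (- f x)))"
    using arg_cong[OF 2, of enn2real] fin by (simp add: enn2real_plus less_top)
  ultimately show ?thesis
    using int by (simp add: real_lebesgue_integral_def)
qed

text \<open>\<open>Y\<close> is a Hahn set for \<open>a - b\<close>, so the supremum over the
  subsets of \<open>A\<close> is attained at \<open>A \<inter> Y\<close>: the positive variation is
  \<open>a - b\<close> restricted to \<open>Y\<close>.\<close>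

lemma pos_variation_diff:
  assumes fin: "finite_measure a" "finite_measure b"
    and sets: "sets a = sets M" "sets b = sets M"
    and nu: "\<And>A. A \<in> sets M \<Longrightarrow> \<nu> A = measure a A - measure b A"
    and Y: "Y \<in> sets M"
    and pos: "\<And>B. B \<in> sets M \<Longrightarrow> B \<subseteq> Y \<Longrightarrow> measure b B \<le> measure a B"
    and neg: "\<And>B. B \<in> sets M \<Longrightarrow> B \<inter> Y = {} \<Longrightarrow> measure a B \<le> measure b B"
  shows "\<And>A. A \<in> sets M \<Longrightarrow>
      emeasure (pos_variation M \<nu>) A = ennreal (measure a (A \<inter> Y) - measure b (A \<inter> Y))"
    and "sets (pos_variation M \<nu>) = sets M"
    and "finite_measure (pos_variation M \<nu>)"
proof -
  interpret a: finite_measure a by fact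
  interpret b: finite_measure b by fact
  \<comment> \<open>\<open>measure_of\<close> turns a set function that is not a measure into the
    zero measure, so the supremum is compared with \<open>p\<close>, which is a measure by
    construction.\<close>
  define p where "p = diff_measure (density a (indicator Y)) (density b (indicator Y))"
  have em: "emeasure (density N (indicator Y)) A = ennreal (measure N (A \<inter> Y))"
    if "A \<in> sets M" "N \<in> {a, b}" for A N
    using that sets Y a.emeasure_eq_measure b.emeasure_eq_measure
    by (auto simp: emeasure_restricted Int_commute)
  have spM: "space a = space M" "space b = space M"
    using sets[THEN sets_eq_imp_space_eq] by auto
  have fin': "finite_measure (density N (indicator Y))" if "N \<in> {a, b}" for N
    using em[OF sets.top that] that spM by (intro finite_measureI) auto
  have p_em: "emeasure p A = ennreal (measure a (A \<inter> Y) - measure b (A \<inter> Y))"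
    if A: "A \<in> sets M" for A
    unfolding p_def
  proof (subst emeasure_diff_measure)
    show "emeasure (density b (indicator Y)) B \<le> emeasure (density a (indicator Y)) B"
      if "B \<in> sets (density a (indicator Y))" for B
      using that sets pos[of "B \<inter> Y"] Y by (simp add: em ennreal_leI)
    show "emeasure (density a (indicator Y)) A - emeasure (density b (indicator Y)) A
        = ennreal (measure a (A \<inter> Y) - measure b (A \<inter> Y))"
      using A by (simp add: em ennreal_minus)
  qed (use fin' A sets in auto)
  have p_sets: "sets p = sets M" and p_space: "space p = space M"
    using sets spM by (auto simp: p_def)
  have sup: "(SUP B\<in>{B \<in> sets M. B \<subseteq> A}. \<nu> B) = measure a (A \<inter> Y) - measure b (A \<inter> Y)"
    if A: "A \<in> sets M" for A
  proof (rule cSup_eq_maximum)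
    show "measure a (A \<inter> Y) - measure b (A \<inter> Y) \<in> \<nu> ` {B \<in> sets M. B \<subseteq> A}"
      using A Y by (intro image_eqI[where x="A \<inter> Y"]) (auto simp: nu)
  next
    fix y assume "y \<in> \<nu> ` {B \<in> sets M. B \<subseteq> A}"
    then obtain B where B: "B \<in> sets M" "B \<subseteq> A" "y = \<nu> B" by auto
    have split: "measure N C = measure N (C \<inter> D) + measure N (C - D)"
      if "N \<in> {a, b}" "C \<in> sets M" "D \<in> sets M" for N C D
      using that sets a.finite_measure_Diff'[of C D] b.finite_measure_Diff'[of C D] by auto
    \<comment> \<open>Discarding \<open>B - Y\<close> from \<open>B\<close> does not lower the value
      of \<open>\<nu>\<close>, and neither does adding \<open>A \<inter> Y - B\<close>
      afterwards.\<close>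
    have 1: "y = (measure a (B \<inter> Y) - measure b (B \<inter> Y)) + (measure a (B - Y) - measure b (B - Y))"
      using split[of a B Y] split[of b B Y] B Y by (simp add: nu)
    have 2: "measure a (B - Y) - measure b (B - Y) \<le> 0"
      using neg[of "B - Y"] B Y by auto
    have *: "A \<inter> Y \<inter> B = B \<inter> Y" "A \<inter> Y - B \<subseteq> Y" using B by auto
    have "measure b (A \<inter> Y - B) \<le> measure a (A \<inter> Y - B)"
      using pos[of "A \<inter> Y - B"] A B Y * by auto
    then show "y \<le> measure a (A \<inter> Y) - measure b (A \<inter> Y)"
      using split[of a "A \<inter> Y" B] split[of b "A \<inter> Y" B] A B(1) Y 1 2 * by simp
  qed
  have "pos_variation M \<nu> = measure_of (space M) (sets M) (emeasure p)"
    unfolding pos_variation_def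
    by (rule measure_of_eq) (auto simp: sets.space_closed sets.sigma_sets_eq sup p_em)
  also have "\<dots> = p"
    using measure_of_of_measure[of p] by (simp add: p_sets p_space)
  finally have eq: "pos_variation M \<nu> = p" .
  show "\<And>A. A \<in> sets M \<Longrightarrow>
      emeasure (pos_variation M \<nu>) A = ennreal (measure a (A \<inter> Y) - measure b (A \<inter> Y))"
    "sets (pos_variation M \<nu>) = sets M"
    by (simp_all add: eq p_em p_sets)
  show "finite_measure (pos_variation M \<nu>)"
    by (rule finite_measureI) (simp add: eq p_space p_em)
qed

text \<open>Any representation of \<open>\<nu>\<close> as a difference of finite measures gives the
  same integral as the Jordan decomposition \<open>p - q\<close>: the two agree on sets in the form
  \<open>p + b = a + q\<close>, which can be integrated.\<close>

lemma signed_integral_diff: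
  fixes f :: "'a \<Rightarrow> real"
  assumes fin: "finite_measure a" "finite_measure b"
    and sets: "sets a = sets M" "sets b = sets M"
    and nu: "\<And>A. A \<in> sets M \<Longrightarrow> \<nu> A = measure a A - measure b A"
    and f: "f \<in> borel_measurable M" and bd: "\<And>x. x \<in> space M \<Longrightarrow> \<bar>f x\<bar> \<le> C"
  shows "signed_integral M \<nu> (\<lambda>x. complex_of_real (f x))
    = complex_of_real (integral\<^sup>L a f - integral\<^sup>L b f)"
proof -
  interpret a: finite_measure a by fact
  interpret b: finite_measure b by fact
  obtain Y where Y: "Y \<in> sets M"
    and pos: "\<And>B. B \<in> sets M \<Longrightarrow> B \<subseteq> Y \<Longrightarrow> measure b B \<le> measure a B"
    and neg: "\<And>B. B \<in> sets M \<Longrightarrow> B \<inter> Y = {} \<Longrightarrow> measure a B \<le> measure b B"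
    using finite_unsigned_Hahn_decomposition[OF fin] sets
    unfolding a.emeasure_eq_measure b.emeasure_eq_measure
    by (metis ennreal_le_iff measure_nonneg)
  \<comment> \<open>The complement of a Hahn set for \<open>\<nu>\<close> is one for
    \<open>-\<nu>\<close>, so the negative variation is obtained with \<open>a\<close> and
    \<open>b\<close> exchanged.\<close>
  define Z where "Z = space M - Y"
  have Z: "Z \<in> sets M" using Y by (simp add: Z_def)
  define p q where "p = pos_variation M \<nu>" and "q = pos_variation M (\<lambda>A. - \<nu> A)"
  note P = pos_variation_diff[OF fin sets nu Y pos neg, folded p_def]
  have sub: "B \<subseteq> Y" if "B \<in> sets M" "B \<inter> Z = {}" for B
    using that sets.sets_into_space[of B M] by (auto simp: Z_def)
  have nu': "- \<nu> A = measure b A - measure a A" if "A \<in> sets M" for A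
    using nu[OF that] by simp
  have pos': "measure a B \<le> measure b B" if "B \<in> sets M" "B \<subseteq> Z" for B
    using that by (intro neg) (auto simp: Z_def)
  have neg': "measure b B \<le> measure a B" if "B \<in> sets M" "B \<inter> Z = {}" for B
    using that sub by (intro pos) auto
  note Q = pos_variation_diff[OF fin(2,1) sets(2,1) nu' Z pos' neg', folded q_def]
  have eq: "emeasure p A + emeasure b A = emeasure a A + emeasure q A" if A: "A \<in> sets M" for A
  proof -
    have AZ: "A \<inter> Z = A - Y"
      using sets.sets_into_space[OF A] by (auto simp: Z_def)
    have "measure a A = measure a (A \<inter> Y) + measure a (A - Y)"
         "measure b A = measure b (A \<inter> Y) + measure b (A - Y)"
      using sets A Y a.finite_measure_Diff'[of A Y] b.finite_measure_Diff'[of A Y] by auto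
    moreover have "measure b (A \<inter> Y) \<le> measure a (A \<inter> Y)" "measure a (A - Y) \<le> measure b (A - Y)"
      using pos[of "A \<inter> Y"] neg[of "A - Y"] A Y by auto
    ultimately show ?thesis
      using A by (simp add: P(1) Q(1) AZ a.emeasure_eq_measure b.emeasure_eq_measure
          ennreal_plus[symmetric] del: ennreal_plus)
  qed
  note int = integrable_bounded[OF _ _ f bd]
  have "integral\<^sup>L p f + integral\<^sup>L b f = integral\<^sup>L a f + integral\<^sup>L q f"
    by (rule integral_add_eq_add[OF P(2) Q(2) sets eq int[OF P(3,2)] int[OF Q(3,2)]
          int[OF fin(1) sets(1)] int[OF fin(2) sets(2)]])
  then have "integral\<^sup>L p f - integral\<^sup>L q f = integral\<^sup>L a f - integral\<^sup>L b f"
    by simp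
  then show ?thesis
    by (simp add: signed_integral_def p_def q_def flip: of_real_diff)
qed

subsection \<open>The real inner product\<close>

text \<open>A real inner product with the same norm. It loses no information, since
  \<open>Im_cinner\<close> recovers the imaginary part.\<close>

abbreviation rinner :: "'h::chilbert_space \<Rightarrow> 'h \<Rightarrow> real" where
  "rinner x y \<equiv> Re (cinner x y)"

lemma rinner_commute: "rinner x y = rinner y x"
  by (subst cinner_commute) simp

lemma rinner_self: "rinner x x = (norm x)\<^sup>2"
  by (simp add: cinner_self)

lemma rinner_add_left: "rinner (x + y) z = rinner x z + rinner y z"
  by (simp add: cinner_add_left)

lemma rinner_add_right: "rinner z (x + y) = rinner z x + rinner z y"
  by (metis rinner_commute rinner_add_left)

lemma rinner_scaleR_left: "rinner (r *\<^sub>R x) y = r * rinner x y"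
  by (simp add: scaleR_scaleC cinner_scaleC_left)

lemma rinner_minus_left: "rinner (- x) y = - rinner x y"
  using rinner_scaleR_left[of "-1" x y] by simp

lemma rinner_minus_right: "rinner x (- y) = - rinner x y"
  by (metis rinner_commute rinner_minus_left)

lemma rinner_polarization: "4 * rinner x y = (norm (x + y))\<^sup>2 - (norm (x - y))\<^sup>2"
  unfolding rinner_self[symmetric] diff_conv_add_uminus
    rinner_add_left rinner_add_right rinner_minus_left rinner_minus_right
  using rinner_commute[of x y] by simp

text \<open>Cauchy-Schwarz from the triangle inequality: in the polarization identity
  \<open>norm (x + y)\<close> is at most the sum and \<open>norm (x - y)\<close> at least the
  difference of the norms, and these squares differ by four times the product.\<close>

lemma abs_rinner_le: "\<bar>rinner x y\<bar> \<le> norm x * norm y"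
proof -
  have le: "rinner x y \<le> norm x * norm y" for x y :: 'a
  proof -
    have "(norm (x + y))\<^sup>2 \<le> (norm x + norm y)\<^sup>2"
      by (intro power_mono norm_triangle_ineq) simp
    moreover have "(norm x - norm y)\<^sup>2 \<le> (norm (x - y))\<^sup>2"
      using norm_triangle_ineq3[of x y] by (metis abs_norm_cancel abs_le_square_iff)
    ultimately have "4 * rinner x y \<le> (norm x + norm y)\<^sup>2 - (norm x - norm y)\<^sup>2"
      unfolding rinner_polarization by linarith
    then show ?thesis by (simp add: power2_eq_square algebra_simps)
  qed
  show ?thesis
    using le[of x y] le[of "-x" y] by (simp add: rinner_minus_left)
qed

interpretation rinner: bounded_bilinear rinner
proof
  show "\<exists>K. \<forall>a b. norm (rinner a b) \<le> norm a * norm b * K"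
    using abs_rinner_le by (intro exI[of _ 1]) auto
next
  show "rinner a (r *\<^sub>R b) = r *\<^sub>R rinner a b" for a b :: 'a and r
    by (metis rinner_commute rinner_scaleR_left real_scaleR_def)
qed (simp_all add: rinner_add_left rinner_add_right rinner_scaleR_left)

text \<open>Conjugate linearity in the second argument turns \<open>\<i>\<close> into
  \<open>-\<i>\<close>, which moves the imaginary part to the real position.\<close>

lemma Im_cinner: "Im (cinner x y) = rinner x (scaleC \<i> y)"
proof -
  have "cinner x (scaleC \<i> y) = cnj (\<i> * cinner y x)"
    by (subst cinner_commute) (simp add: cinner_scaleC_left)
  also have "\<dots> = - \<i> * cinner x y"
    by (subst cinner_commute[of x y]) simp
  finally show ?thesis by simp
qed

lemma norm_scaleC: "norm (scaleC c x) = cmod c * norm x"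
proof -
  have "cinner (scaleC c x) (scaleC c x) = c * cnj c * cinner x x"
    using cinner_scaleC_left[of c x "scaleC c x"] cinner_scaleC_left[of c x x]
      cinner_commute[of x "scaleC c x"] cinner_commute[of x x] by simp
  then have "(norm (scaleC c x))\<^sup>2 = (cmod c * norm x)\<^sup>2"
    unfolding cinner_self complex_norm_square[symmetric] power_mult_distrib
    by (metis of_real_eq_iff of_real_mult)
  then show ?thesis by (simp add: power2_eq_iff_nonneg)
qed

lemma bounded_linear_scaleC: "bounded_linear (scaleC c)"
proof
  show "scaleC c (r *\<^sub>R x) = r *\<^sub>R scaleC c x" for r x
    by (simp add: scaleR_scaleC scaleC_scaleC mult.commute)
  show "\<exists>K. \<forall>x. norm (scaleC c x) \<le> norm x * K"
    by (intro exI[of _ "cmod c"]) (simp add: norm_scaleC mult.commute)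
qed (rule scaleC_add_right)

subsection \<open>Symmetric operators\<close>

text \<open>These are the self-adjoint operators: for complex-linear maps, symmetry of
  \<open>rinner\<close> carries over to \<open>cinner\<close> by \<open>Im_cinner\<close>. Unlike
  the projections they form a closed real subspace, which therefore contains the limits of real
  combinations of projections.\<close>

definition symmetric_ops :: "('h::chilbert_space \<Rightarrow>\<^sub>L 'h) set" where
  "symmetric_ops = {T \<in> bounded_ops. \<forall>x y. rinner (T x) y = rinner x (T y)}"

lemma orth_projections_symmetric: "orth_projections \<subseteq> symmetric_ops"
  by (auto simp: orth_projections_def symmetric_ops_def)

lemma symmetric_opsD:
  assumes "T \<in> symmetric_ops"
  shows "T \<in> bounded_ops" "rinner (blinfun_apply T x) y = rinner x (blinfun_apply T y)"
  using assms by (auto simp: symmetric_ops_def)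

lemma subspace_bounded_ops: "subspace (bounded_ops :: ('h::chilbert_space \<Rightarrow>\<^sub>L 'h) set)"
proof -
  interpret S: bounded_linear "scaleC c :: 'h \<Rightarrow> 'h" for c
    by (rule bounded_linear_scaleC)
  show ?thesis
    by (auto simp: subspace_def bounded_ops_def plus_blinfun.rep_eq scaleR_blinfun.rep_eq
        S.zero S.add S.scaleR)
qed

lemma subspace_symmetric_ops: "subspace symmetric_ops"
  using subspace_bounded_ops
  by (auto simp: subspace_def symmetric_ops_def plus_blinfun.rep_eq scaleR_blinfun.rep_eq
      rinner.add_left rinner.add_right rinner.scaleR_left rinner.scaleR_right
      rinner.zero_left rinner.zero_right)

lemma closed_symmetric_ops: "closed (symmetric_ops :: ('h::chilbert_space \<Rightarrow>\<^sub>L 'h) set)"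
proof -
  have eq: "symmetric_ops = (\<Inter>c x. {T :: 'h \<Rightarrow>\<^sub>L 'h. blinfun_apply T (scaleC c x) = scaleC c (blinfun_apply T x)}) \<inter>
      (\<Inter>x y. {T. rinner (blinfun_apply T x) y = rinner x (blinfun_apply T y)})"
    by (auto simp: symmetric_ops_def bounded_ops_def)
  have 1: "closed {T :: 'h \<Rightarrow>\<^sub>L 'h. blinfun_apply T (scaleC c x) = scaleC c (blinfun_apply T x)}" for c x
    by (intro closed_Collect_eq continuous_intros bounded_linear.continuous_on[OF bounded_linear_scaleC])
  have 2: "closed {T :: 'h \<Rightarrow>\<^sub>L 'h. rinner (blinfun_apply T x) y = rinner x (blinfun_apply T y)}" for x y
    by (intro closed_Collect_eq continuous_intros rinner.continuous_on)
  show ?thesis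
    unfolding eq by (intro closed_Int closed_INT ballI 1 2)
qed

text \<open>Two squares suffice because the real form of a symmetric operator is symmetric. The
  factor 1/2 sits inside the vectors so that the right side becomes a plain difference of two
  measures when \<open>T\<close> is replaced by \<open>F A\<close>.\<close>

lemma symmetric_polarization:
  assumes "T \<in> symmetric_ops"
  defines "q \<equiv> \<lambda>u. rinner (blinfun_apply T u) u"
  shows "rinner (blinfun_apply T g) h = q ((1/2) *\<^sub>R (g + h)) - q ((1/2) *\<^sub>R (g - h))"
proof -
  have "rinner (blinfun_apply T h) g = rinner (blinfun_apply T g) h"
    using symmetric_opsD(2)[OF assms(1)] rinner_commute by metis
  then show ?thesis
    by (simp add: q_def blinfun.scaleR_right blinfun.add_right blinfun.diff_right
        rinner.scaleR_left rinner.scaleR_right rinner.add_left rinner.add_right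
        rinner.diff_left rinner.diff_right field_simps)
qed

lemma symmetric_op_eqI:
  assumes "S \<in> symmetric_ops" "T \<in> symmetric_ops"
    and "\<And>g. rinner (blinfun_apply S g) g = rinner (blinfun_apply T g) g"
  shows "S = T"
proof (rule blinfun_eqI)
  fix g
  have "rinner (blinfun_apply S g) h = rinner (blinfun_apply T g) h" for h
    using symmetric_polarization[OF assms(1), of g h] symmetric_polarization[OF assms(2), of g h]
    by (simp only: assms(3))
  then have "rinner (blinfun_apply S g - blinfun_apply T g) (blinfun_apply S g - blinfun_apply T g) = 0"
    by (simp add: rinner.diff_left)
  then show "blinfun_apply S g = blinfun_apply T g"
    by (simp add: rinner_self)
qed

text \<open>Write \<open>p\<close> as \<open>p o\<^sub>L p\<close> and move one factor to the other
  side. This makes the diagonal set functions of a projection-valued measure nonnegative.\<close>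

lemma orth_projection_quadratic:
  assumes "p \<in> orth_projections"
  shows "rinner (blinfun_apply p g) g = (norm (blinfun_apply p g))\<^sup>2"
proof -
  have "p o\<^sub>L p = p" "cinner (blinfun_apply p g) (blinfun_apply p g) = cinner (blinfun_apply p (blinfun_apply p g)) g"
    using assms by (auto simp: orth_projections_def)
  moreover have "blinfun_apply p (blinfun_apply p g) = blinfun_apply (p o\<^sub>L p) g"
    by (simp add: blinfun_apply_blinfun_compose)
  ultimately show ?thesis
    by (metis rinner_self)
qed

lemma norm_orth_projection_le_1:
  assumes "p \<in> orth_projections"
  shows "norm p \<le> 1"
proof (rule norm_blinfun_bound)
  fix g
  have "(norm (blinfun_apply p g))\<^sup>2 \<le> norm (blinfun_apply p g) * norm g"
    using abs_rinner_le[of "blinfun_apply p g" g] by (simp add: orth_projection_quadratic[OF assms])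
  then show "norm (blinfun_apply p g) \<le> 1 * norm g"
    by (cases "norm (blinfun_apply p g) = 0") (auto simp: power2_eq_square mult_le_cancel_left)
qed simp

subsection \<open>The scalar measures of a projection-valued measure\<close>

text \<open>This is the positive measure \<open>F_{g,g}\<close> of the diagonal. That the set
  function is countably additive, as \<open>measure_of\<close> needs, is established in
  \<open>emeasure_scalar_measure\<close>.\<close>

definition scalar_measure ::
  "'a::metric_space set \<Rightarrow> ('a set \<Rightarrow> 'h::chilbert_space \<Rightarrow>\<^sub>L 'h) \<Rightarrow> 'h \<Rightarrow> 'a measure" where
  "scalar_measure X F g = measure_of (space (borel_on X)) (sets (borel_on X))
     (\<lambda>A. ennreal (rinner (blinfun_apply (F A) g) g))"

lemma pvmsD:
  assumes "F \<in> pvms X"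
  shows "A \<in> sets (borel_on X) \<Longrightarrow> F A \<in> orth_projections" "F {} = 0" "F X = id_blinfun"
    "range B \<subseteq> sets (borel_on X) \<Longrightarrow> disjoint_family B \<Longrightarrow>
      (\<lambda>n. blinfun_apply (F (B n)) g) sums blinfun_apply (F (\<Union>n. B n)) g"
  using assms by (auto simp: pvms_def PiE_iff)

lemma pvm_quadratic_nonneg:
  assumes "F \<in> pvms X" "A \<in> sets (borel_on X)"
  shows "0 \<le> rinner (blinfun_apply (F A) g) g"
  using orth_projection_quadratic[OF pvmsD(1)[OF assms]] by simp

lemma space_scalar_measure [simp]: "space (scalar_measure X F g) = X"
  and sets_scalar_measure [simp, measurable_cong]:
    "sets (scalar_measure X F g) = sets (borel_on X)"
  unfolding scalar_measure_def sets.sets_measure_of_eq sets.space_measure_of_eq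
  by (simp_all add: space_restrict_space)

lemma emeasure_scalar_measure:
  assumes F: "F \<in> pvms X" and A: "A \<in> sets (borel_on X)"
  shows "emeasure (scalar_measure X F g) A = ennreal (rinner (blinfun_apply (F A) g) g)"
  unfolding scalar_measure_def
proof (rule emeasure_measure_of_sigma[OF _ _ _ A])
  let ?\<mu> = "\<lambda>A. ennreal (rinner (blinfun_apply (F A) g) g)"
  show "sigma_algebra (space (borel_on X)) (sets (borel_on X))" ..
  show "positive (sets (borel_on X)) ?\<mu>"
    by (simp add: positive_def pvmsD(2)[OF F] rinner.zero_left)
  show "countably_additive (sets (borel_on X)) ?\<mu>"
  proof (rule countably_additiveI)
    fix B :: "nat \<Rightarrow> 'a set"
    assume B: "range B \<subseteq> sets (borel_on X)" "disjoint_family B"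
    have "(\<lambda>n. rinner (blinfun_apply (F (B n)) g) g) sums rinner (blinfun_apply (F (\<Union>n. B n)) g) g"
      by (rule bounded_linear.sums[OF rinner.bounded_linear_left pvmsD(4)[OF F B]])
    then show "(\<Sum>i. ?\<mu> (B i)) = ?\<mu> (\<Union>i. B i)"
      using B(1) pvm_quadratic_nonneg[OF F]
      by (subst suminf_ennreal2) (auto simp: sums_iff)
  qed
qed

lemma finite_scalar_measure:
  assumes "F \<in> pvms X"
  shows "finite_measure (scalar_measure X F g)"
proof (rule finite_measureI)
  have "X \<in> sets (borel_on X)"
    using sets.top[of "borel_on X"] by (simp add: space_restrict_space)
  then show "emeasure (scalar_measure X F g) (space (scalar_measure X F g)) \<noteq> \<infinity>"
    by (simp add: emeasure_scalar_measure assms)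
qed

lemma measure_scalar_measure:
  assumes "F \<in> pvms X" "A \<in> sets (borel_on X)"
  shows "measure (scalar_measure X F g) A = rinner (blinfun_apply (F A) g) g"
  by (simp add: measure_def emeasure_scalar_measure assms pvm_quadratic_nonneg[OF assms])

subsection \<open>Integrals against a projection-valued measure\<close>

text \<open>Polarization of each \<open>F A\<close> writes the off-diagonal set function as a
  difference of the scalar measures at half of \<open>g + h\<close> and half of
  \<open>g - h\<close>; polarization of \<open>T\<close> does the same to the right side.\<close>

lemma signed_integral_pvm:
  fixes f :: "'a::metric_space \<Rightarrow> real"
  assumes F: "F \<in> pvms X" and T: "T \<in> symmetric_ops"
    and f: "f \<in> borel_measurable (borel_on X)" "\<And>x. x \<in> X \<Longrightarrow> \<bar>f x\<bar> \<le> C"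
    and quad: "\<And>g. rinner (blinfun_apply T g) g = integral\<^sup>L (scalar_measure X F g) f"
  shows "signed_integral (borel_on X) (\<lambda>A. rinner (blinfun_apply (F A) g) h) (\<lambda>x. complex_of_real (f x))
    = complex_of_real (rinner (blinfun_apply T g) h)"
  unfolding symmetric_polarization[OF T, of g h] quad
proof (rule signed_integral_diff[OF finite_scalar_measure[OF F] finite_scalar_measure[OF F] _ _ _ f(1)])
  fix A assume A: "A \<in> sets (borel_on X)"
  then have "F A \<in> symmetric_ops"
    using pvmsD(1)[OF F] orth_projections_symmetric by auto
  from symmetric_polarization[OF this, of g h]
  show "rinner (blinfun_apply (F A) g) h = measure (scalar_measure X F ((1/2) *\<^sub>R (g + h))) A -
      measure (scalar_measure X F ((1/2) *\<^sub>R (g - h))) A"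
    by (simp add: measure_scalar_measure[OF F A])
qed (use f(2) in \<open>auto simp: space_restrict_space\<close>)

text \<open>Equality of quadratic forms characterizes the integral. Polarization gives the real part
  of the defining equation, and replacing \<open>h\<close> by \<open>scaleC \<i> h\<close> gives the
  imaginary part. Any other solution has the same form as \<open>T\<close>, so it is symmetric and
  equal to \<open>T\<close>.\<close>

lemma pvm_integral_eqI:
  fixes f :: "'a::metric_space \<Rightarrow> real"
  assumes F: "F \<in> pvms X" and T: "T \<in> symmetric_ops"
    and f: "f \<in> borel_measurable (borel_on X)" "\<And>x. x \<in> X \<Longrightarrow> \<bar>f x\<bar> \<le> C"
    and quad: "\<And>g. rinner (blinfun_apply T g) g = integral\<^sup>L (scalar_measure X F g) f"
  shows "pvm_integral X F (\<lambda>x. complex_of_real (f x)) = T"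
  unfolding pvm_integral_def
proof (rule the_equality)
  have eq: "cinner (blinfun_apply T g) h = complex_measure_integral (borel_on X)
      (\<lambda>A. cinner (blinfun_apply (F A) g) h) (\<lambda>x. complex_of_real (f x))" for g h
    by (simp add: complex_measure_integral_def Im_cinner signed_integral_pvm[OF assms] complex_eq_iff)
  then show "T \<in> bounded_ops \<and> (\<forall>g h. cinner (blinfun_apply T g) h = complex_measure_integral (borel_on X)
      (\<lambda>A. cinner (blinfun_apply (F A) g) h) (\<lambda>x. complex_of_real (f x)))"
    using symmetric_opsD(1)[OF T] by simp
  fix S
  assume S: "S \<in> bounded_ops \<and> (\<forall>g h. cinner (blinfun_apply S g) h = complex_measure_integral (borel_on X)
      (\<lambda>A. cinner (blinfun_apply (F A) g) h) (\<lambda>x. complex_of_real (f x)))"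
  then have *: "cinner (blinfun_apply S g) h = cinner (blinfun_apply T g) h" for g h
    by (simp add: eq)
  then have "S \<in> symmetric_ops"
    using S T * by (simp add: symmetric_ops_def) (metis rinner_commute)
  with T show "S = T"
    by (intro symmetric_op_eqI) (simp_all add: *)
qed

section \<open>Existence and bounds through binary digits\<close>

text \<open>The digit of index \<open>0\<close> is the first one after the binary point.\<close>

definition bin_digit :: "nat \<Rightarrow> real \<Rightarrow> int" where
  "bin_digit k t = \<lfloor>2 ^ Suc k * t\<rfloor> mod 2"

text \<open>Passing from \<open>n\<close> to \<open>n + 1\<close> appends one binary digit to the
  floor of \<open>2 ^ n * t\<close>. Hence the partial sums are these floors divided by
  \<open>2 ^ n\<close>, within \<open>(1/2) ^ n\<close> of \<open>t\<close>; \<open>t < 1\<close>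
  makes the first floor 0.\<close>

lemma bin_digit_sums:
  assumes "0 \<le> t" "t < 1"
  shows "(\<lambda>k. (1/2) ^ Suc k * real_of_int (bin_digit k t)) sums t"
proof -
  have partial: "(\<Sum>k<n. (1/2) ^ Suc k * real_of_int (bin_digit k t)) = \<lfloor>2 ^ n * t\<rfloor> / 2 ^ n" for n
  proof (induction n)
    case 0
    with assms show ?case by (simp add: floor_eq_iff)
  next
    case (Suc n)
    have "\<lfloor>2 ^ n * t\<rfloor> = \<lfloor>2 ^ Suc n * t\<rfloor> div 2"
      using floor_divide_real_eq_div[of 2 "2 ^ Suc n * t"] by simp
    then have "\<lfloor>2 ^ Suc n * t\<rfloor> = 2 * \<lfloor>2 ^ n * t\<rfloor> + bin_digit n t"
      by (simp only: bin_digit_def mult_div_mod_eq)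
    then have "real_of_int \<lfloor>2 ^ Suc n * t\<rfloor> = 2 * real_of_int \<lfloor>2 ^ n * t\<rfloor> + real_of_int (bin_digit n t)"
      by (metis of_int_add of_int_mult of_int_numeral)
    with Suc show ?case
      by (simp add: field_simps)
  qed
  have "(\<lambda>n. \<lfloor>2 ^ n * t\<rfloor> / 2 ^ n) \<longlonglongrightarrow> t"
  proof (rule LIM_zero_cancel)
    show "(\<lambda>n. \<lfloor>2 ^ n * t\<rfloor> / 2 ^ n - t) \<longlonglongrightarrow> 0"
    proof (rule Lim_null_comparison)
      have "\<bar>\<lfloor>2 ^ n * t\<rfloor> / 2 ^ n - t\<bar> \<le> (1/2) ^ n" for n
      proof -
        have "\<bar>\<lfloor>2 ^ n * t\<rfloor> - 2 ^ n * t\<bar> \<le> 1" by linarith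
        moreover have "\<lfloor>2 ^ n * t\<rfloor> / 2 ^ n - t = (\<lfloor>2 ^ n * t\<rfloor> - 2 ^ n * t) / 2 ^ n"
          by (simp add: field_simps)
        ultimately show ?thesis
          by (simp add: abs_divide power_one_over divide_right_mono)
      qed
      then show "\<forall>\<^sub>F n in sequentially. norm (\<lfloor>2 ^ n * t\<rfloor> / 2 ^ n - t) \<le> (1/2) ^ n"
        by simp
      show "(\<lambda>n. (1/2::real) ^ n) \<longlonglongrightarrow> 0"
        by (rule LIMSEQ_power_zero) simp
    qed
  qed
  then show ?thesis
    by (simp only: sums_def partial)
qed

lemma exists_pvm_integral_unit:
  fixes f :: "'a::metric_space \<Rightarrow> real" and F :: "'a set \<Rightarrow> 'h::chilbert_space \<Rightarrow>\<^sub>L 'h"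
  assumes F: "F \<in> pvms X" and f: "f \<in> borel_measurable (borel_on X)"
    and bd: "\<And>x. x \<in> X \<Longrightarrow> 0 \<le> f x \<and> f x < 1"
  obtains S where "S \<in> symmetric_ops" "norm S \<le> 1"
    "\<And>g. rinner (blinfun_apply S g) g = integral\<^sup>L (scalar_measure X F g) f"
proof -
  define A where "A k = {x \<in> space (borel_on X). bin_digit k (f x) = 1}" for k
  have A: "A k \<in> sets (borel_on X)" for k
    unfolding A_def bin_digit_def using f by measurable
  have P: "F (A k) \<in> orth_projections" for k
    using pvmsD(1)[OF F A] .
  define S where "S = (\<Sum>k. (1/2) ^ Suc k *\<^sub>R F (A k))"
  \<comment> \<open>Projections have norm at most 1 and the coefficients add up to 1, so the series
    converges absolutely and its sum has norm at most 1.\<close>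
  have le: "norm ((1/2) ^ Suc k *\<^sub>R F (A k)) \<le> (1/2) ^ Suc k" for k
    using norm_orth_projection_le_1[OF P] by (simp add: mult_left_le)
  have sm: "summable (\<lambda>k. norm ((1/2) ^ Suc k *\<^sub>R F (A k)))"
    using le by (intro summable_comparison_test'[OF sums_summable[OF power_half_series]]) simp
  have S: "(\<lambda>k. (1/2) ^ Suc k *\<^sub>R F (A k)) sums S"
    unfolding S_def by (rule summable_sums[OF summable_norm_cancel[OF sm]])
  have "norm S \<le> (\<Sum>k. norm ((1/2) ^ Suc k *\<^sub>R F (A k)))"
    unfolding S_def by (rule summable_norm[OF sm])
  also have "\<dots> \<le> 1"
    using suminf_le[OF le sm sums_summable[OF power_half_series]]
    by (simp only: sums_unique[OF power_half_series, symmetric])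
  finally have "norm S \<le> 1" .
  moreover have "S \<in> symmetric_ops"
  proof (rule closed_sequentially[OF closed_symmetric_ops _ S[unfolded sums_def]])
    show "(\<Sum>k<n. (1/2) ^ Suc k *\<^sub>R F (A k)) \<in> symmetric_ops" for n
      using P orth_projections_symmetric
      by (intro subspace_sum subspace_scale subspace_symmetric_ops) auto
  qed
  moreover have "rinner (blinfun_apply S g) g = integral\<^sup>L (scalar_measure X F g) f" for g
  proof -
    let ?M = "scalar_measure X F g"
    interpret finite_measure ?M by (rule finite_scalar_measure[OF F])
    let ?u = "\<lambda>k x. (1/2) ^ Suc k * indicator (A k) x :: real"
    have "bounded_linear (\<lambda>T. rinner (blinfun_apply T g) g)"
      by (rule bounded_linear_compose[OF rinner.bounded_linear_left blinfun.bounded_linear_left])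
    \<comment> \<open>Evaluating the quadratic form at \<open>g\<close> is continuous and linear in
      the operator, so it may be applied term by term.\<close>
    from bounded_linear.sums[OF this S]
    have 1: "(\<lambda>k. (1/2) ^ Suc k * measure ?M (A k)) sums rinner (blinfun_apply S g) g"
      by (simp add: scaleR_blinfun.rep_eq rinner.scaleR_left measure_scalar_measure[OF F A])
    have u: "(\<lambda>k. ?u k x) sums f x" if "x \<in> X" for x
    proof -
      have "real_of_int (bin_digit k (f x)) = indicator (A k) x" for k
        using that by (auto simp: A_def indicator_def space_restrict_space bin_digit_def)
      then show ?thesis
        using bin_digit_sums[of "f x"] bd[OF that] by simp
    qed
    have int: "integrable ?M (?u k)" for k
      using A by (intro integrable_mult_right) (auto simp: less_top[symmetric])
    have intu: "integral\<^sup>L ?M (?u k) = (1/2) ^ Suc k * measure ?M (A k)" for k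
      using A sets.sets_into_space[OF A[of k]] by (simp add: space_restrict_space Int_absorb2)
    have nu: "norm (?u k x) = ?u k x" for k x
      by simp
    \<comment> \<open>Sum and integral may be exchanged: the terms are nonnegative, so the integrals
      of their norms form the convergent series of fact \<open>1\<close>.\<close>
    have "(\<lambda>k. integral\<^sup>L ?M (?u k)) sums integral\<^sup>L ?M (\<lambda>x. \<Sum>k. ?u k x)"
    proof (rule sums_integral[OF int])
      show "AE x in ?M. summable (\<lambda>k. norm (?u k x))"
        unfolding nu using sums_summable[OF u] by auto
      show "summable (\<lambda>k. integral\<^sup>L ?M (\<lambda>x. norm (?u k x)))"
        unfolding nu intu by (rule sums_summable[OF 1])
    qed
    moreover have "integral\<^sup>L ?M (\<lambda>x. \<Sum>k. ?u k x) = integral\<^sup>L ?M f"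
      by (rule Bochner_Integration.integral_cong) (simp_all only: space_scalar_measure sums_unique[OF u, symmetric])
    ultimately show ?thesis
      unfolding intu using sums_unique2[OF 1] by simp
  qed
  ultimately show ?thesis by (intro that) auto
qed

text \<open>Rescaling \<open>f\<close> to \<open>(f - m) / c\<close>, with values in
  \<open>[0, 1)\<close>, gives an operator \<open>S\<close> of norm at most 1, and the integral of
  \<open>f\<close> is \<open>m *\<^sub>R id_blinfun + c *\<^sub>R S\<close>.\<close>

lemma pvm_integral_bounds:
  fixes f :: "'a::metric_space \<Rightarrow> real" and F :: "'a set \<Rightarrow> 'h::chilbert_space \<Rightarrow>\<^sub>L 'h"
  assumes F: "F \<in> pvms X" and f: "f \<in> borel_measurable (borel_on X)"
    and c: "0 < c" and bd: "\<And>x. x \<in> X \<Longrightarrow> m \<le> f x \<and> f x < m + c"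
  defines "T \<equiv> pvm_integral X F (\<lambda>x. complex_of_real (f x))"
  shows "norm (T - m *\<^sub>R id_blinfun) \<le> c"
    and "rinner (blinfun_apply T g) g = integral\<^sup>L (scalar_measure X F g) f"
proof -
  let ?h = "\<lambda>x. (f x - m) / c"
  obtain S where S: "S \<in> symmetric_ops" "norm S \<le> 1"
    "\<And>g. rinner (blinfun_apply S g) g = integral\<^sup>L (scalar_measure X F g) ?h"
  proof (rule exists_pvm_integral_unit[OF F, of ?h])
    show "?h \<in> borel_measurable (borel_on X)"
      using f by measurable
    show "0 \<le> ?h x \<and> ?h x < 1" if "x \<in> X" for x
      using bd[OF that] c by (simp add: field_simps)
  qed blast
  define R where "R = m *\<^sub>R id_blinfun + c *\<^sub>R S"
  have "id_blinfun \<in> (symmetric_ops :: ('h \<Rightarrow>\<^sub>L 'h) set)"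
    by (simp add: symmetric_ops_def bounded_ops_def)
  then have R: "R \<in> symmetric_ops"
    unfolding R_def by (intro subspace_add subspace_scale subspace_symmetric_ops S(1))
  have f_bd: "\<bar>f x\<bar> \<le> \<bar>m\<bar> + c" if "x \<in> X" for x
    using bd[OF that] by linarith
  have quad: "rinner (blinfun_apply R g) g = integral\<^sup>L (scalar_measure X F g) f" for g
  proof -
    let ?M = "scalar_measure X F g"
    interpret finite_measure ?M by (rule finite_scalar_measure[OF F])
    have "integrable ?M f"
      by (rule integrable_bounded[OF finite_scalar_measure[OF F] _ f])
        (auto simp: space_restrict_space intro: f_bd)
    moreover have "X \<in> sets (borel_on X)"
      using sets.top[of "borel_on X"] by (simp add: space_restrict_space)
    \<comment> \<open>Since \<open>F X\<close> is the identity, the constant \<open>m\<close>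
      integrates to \<open>m\<close> times the identity.\<close>
    then have "measure ?M X = rinner g g"
      by (simp add: measure_scalar_measure[OF F] pvmsD(3)[OF F])
    ultimately have "integral\<^sup>L ?M ?h = (integral\<^sup>L ?M f - m * rinner g g) / c"
      by (simp add: mult.commute)
    then show ?thesis
      using c S(3)[of g]
      by (simp add: R_def plus_blinfun.rep_eq scaleR_blinfun.rep_eq rinner.add_left rinner.scaleR_left)
  qed
  have T: "T = R"
    unfolding T_def by (rule pvm_integral_eqI[OF F R f f_bd quad])
  show "norm (T - m *\<^sub>R id_blinfun) \<le> c"
    using S(2) c by (simp add: T R_def mult_left_le)
  show "rinner (blinfun_apply T g) g = integral\<^sup>L (scalar_measure X F g) f"
    unfolding T by (rule quad)
qed

subsection \<open>Lipschitz functions\<close>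

lemma Lip1_measurable:
  "\<phi> \<in> Lip1 X \<Longrightarrow> \<phi> \<in> borel_measurable (borel_on X)"
  unfolding Lip1_def
  by (auto intro!: borel_measurable_continuous_on_restrict lipschitz_on_continuous_on)

lemma Lip1_range:
  assumes "compact X" "\<phi> \<in> Lip1 X"
  obtains m where "\<And>x. x \<in> X \<Longrightarrow> m \<le> \<phi> x \<and> \<phi> x < m + (2 * diameter X + 1)"
proof (cases "X = {}")
  case False
  then obtain a where a: "a \<in> X" by auto
  have "\<bar>\<phi> x - \<phi> a\<bar> \<le> diameter X" if "x \<in> X" for x
  proof -
    have "dist (\<phi> x) (\<phi> a) \<le> dist x a"
      using assms(2) that a lipschitz_onD[of 1 X \<phi> x a] by (simp add: Lip1_def)
    also have "\<dots> \<le> diameter X"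
      using that a assms(1) by (intro diameter_bounded_bound compact_imp_bounded)
    finally show ?thesis by (simp add: dist_real_def)
  qed
  \<comment> \<open>The width is twice the diameter because \<open>\<phi>\<close> may deviate to
    either side of its value at \<open>a\<close>. The extra 1 makes the upper bound strict and keeps
    the width positive for a single point.\<close>
  then show ?thesis
    by (intro that[of "\<phi> a - diameter X"]) (smt (verit))
qed (use that in auto)

lemma pvm_integral_Lip1:
  fixes X :: "'a::metric_space set" and F :: "'a set \<Rightarrow> 'h::chilbert_space \<Rightarrow>\<^sub>L 'h"
  assumes "compact X" "F \<in> pvms X" "\<phi> \<in> Lip1 X"
  shows "rinner (blinfun_apply (pvm_integral X F (\<lambda>x. complex_of_real (\<phi> x))) g) g =
    integral\<^sup>L (scalar_measure X F g) \<phi>"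
proof -
  obtain m where m: "\<And>x. x \<in> X \<Longrightarrow> m \<le> \<phi> x \<and> \<phi> x < m + (2 * diameter X + 1)"
    by (rule Lip1_range[OF assms(1,3)]) blast
  have "0 < 2 * diameter X + 1"
    using diameter_ge_0[OF compact_imp_bounded[OF assms(1)]] by simp
  from pvm_integral_bounds(2)[OF assms(2) Lip1_measurable[OF assms(3)] this m]
  show ?thesis .
qed

text \<open>The lower bound \<open>m\<close> depends on \<open>\<phi>\<close> alone, so both
  integrals are close to the same multiple of the identity; the triangle inequality doubles the
  width.\<close>

lemma pvm_diff_le:
  fixes X :: "'a::metric_space set" and E F :: "'a set \<Rightarrow> 'h::chilbert_space \<Rightarrow>\<^sub>L 'h"
  assumes "compact X" "E \<in> pvms X" "F \<in> pvms X" "d \<in> pvm_diffs X E F"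
  shows "d \<le> 2 * (2 * diameter X + 1)"
proof -
  obtain \<phi> where \<phi>: "\<phi> \<in> Lip1 X" and d: "d = norm (pvm_integral X E (\<lambda>x. complex_of_real (\<phi> x)) -
      pvm_integral X F (\<lambda>x. complex_of_real (\<phi> x)))" (is "d = norm (?S - ?T)")
    using assms(4) by (auto simp: pvm_diffs_def)
  obtain m where m: "\<And>x. x \<in> X \<Longrightarrow> m \<le> \<phi> x \<and> \<phi> x < m + (2 * diameter X + 1)"
    by (rule Lip1_range[OF assms(1) \<phi>]) blast
  have c: "0 < 2 * diameter X + 1"
    using diameter_ge_0[OF compact_imp_bounded[OF assms(1)]] by simp
  have "norm (?S - ?T) \<le> norm (?S - m *\<^sub>R id_blinfun) + norm (?T - m *\<^sub>R id_blinfun)"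
    using norm_triangle_ineq4[of "?S - m *\<^sub>R id_blinfun" "?T - m *\<^sub>R id_blinfun"] by simp
  also have "\<dots> \<le> (2 * diameter X + 1) + (2 * diameter X + 1)"
    by (rule add_mono[OF pvm_integral_bounds(1)[OF assms(2) Lip1_measurable[OF \<phi>] c m]
          pvm_integral_bounds(1)[OF assms(3) Lip1_measurable[OF \<phi>] c m]])
  finally show ?thesis unfolding d by simp
qed

section \<open>Lipschitz functions determine the measure\<close>

lemma Lip1_infdist: "(\<lambda>x. max 0 (c - infdist x C)) \<in> Lip1 X"
proof -
  have "\<bar>max 0 (c - infdist x C) - max 0 (c - infdist y C)\<bar> \<le> dist x y" for x y
    using infdist_triangle_abs[of x C y] by (auto simp: max_def abs_if split: if_splits)
  then show ?thesis
    by (auto simp: Lip1_def lipschitz_on_def dist_real_def)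
qed

text \<open>Dominated convergence with bound 1. The factor \<open>real (Suc n)\<close> stays outside
  the integral so that the integrand is 1-Lipschitz.\<close>

lemma tendsto_integral_infdist:
  fixes X C :: "'a::metric_space set"
  assumes fin: "finite_measure M" and sets: "sets M = sets (borel_on X)"
    and C: "closed C" "C \<noteq> {}"
  shows "(\<lambda>n. real (Suc n) * integral\<^sup>L M (\<lambda>x. max 0 (1 / real (Suc n) - infdist x C)))
    \<longlonglongrightarrow> measure M (C \<inter> X)"
proof -
  interpret finite_measure M by fact
  let ?u = "\<lambda>n x. real (Suc n) * max 0 (1 / real (Suc n) - infdist x C)"
  have space: "space M = X"
    using sets_eq_imp_space_eq[OF sets] by (simp add: space_restrict_space)
  have meas: "?u n \<in> borel_measurable M" for n
    using Lip1_measurable[OF Lip1_infdist[of "1 / real (Suc n)" C X]] sets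
    by (auto cong: measurable_cong_sets)
  have CX: "C \<inter> X \<in> sets M"
    using C(1) sets by (auto simp: sets_restrict_space)
  have lim: "(\<lambda>n. ?u n x) \<longlonglongrightarrow> indicator (C \<inter> X) x" if "x \<in> X" for x
  proof (cases "x \<in> C")
    case True
    then have "?u n x = 1" for n by simp
    with True that show ?thesis by simp
  next
    case False
    \<comment> \<open>Off the closed set \<open>C\<close> the distance is positive. For an empty
      \<open>C\<close>, \<open>infdist\<close> would have the default value 0.\<close>
    then have pos: "0 < infdist x C"
      using C in_closed_iff_infdist_zero[of C x] infdist_nonneg[of x C] by force
    then obtain N where N: "1 / real (Suc N) < infdist x C"
      using nat_approx_posE by metis
    have "?u n x = 0" if "N \<le> n" for n
    proof -
      have "1 / real (Suc n) \<le> 1 / real (Suc N)"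
        using that by (simp add: field_simps)
      with N show ?thesis by simp
    qed
    then have "(\<lambda>n. ?u n x) \<longlonglongrightarrow> 0"
      by (intro tendsto_eventually eventually_sequentiallyI)
    with False show ?thesis by simp
  qed
  have le: "norm (?u n x) \<le> 1" for n x
  proof -
    have "?u n x \<le> real (Suc n) * (1 / real (Suc n))"
      using infdist_nonneg[of x C] by (intro mult_left_mono) auto
    then show ?thesis by simp
  qed
  have "(\<lambda>n. integral\<^sup>L M (?u n)) \<longlonglongrightarrow> integral\<^sup>L M (indicator (C \<inter> X))"
    using lim le meas CX
    by (intro integral_dominated_convergence[where w="\<lambda>_. 1"]) (auto simp: space)
  then show ?thesis
    using CX space by simp
qed

text \<open>The measures agree on closed sets by the preceding limit, and closed sets are an
  intersection-stable generator of the Borel sets. Both measures are pushed forward to the whole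
  type, where this generator is available.\<close>

lemma measure_eqI_Lip1:
  fixes X :: "'a::metric_space set"
  assumes fin: "finite_measure M" "finite_measure N"
    and sets: "sets M = sets (borel_on X)" "sets N = sets (borel_on X)"
    and eq: "\<And>\<phi>. \<phi> \<in> Lip1 X \<Longrightarrow> integral\<^sup>L M \<phi> = integral\<^sup>L N \<phi>"
    and A: "A \<in> sets (borel_on X)"
  shows "measure M A = measure N A"
proof -
  interpret M: finite_measure M by fact
  interpret N: finite_measure N by fact
  have space: "space M = X" "space N = X"
    using sets[THEN sets_eq_imp_space_eq] by (simp_all add: space_restrict_space)
  have closed_eq: "measure M (C \<inter> X) = measure N (C \<inter> X)" if "closed C" for C
  proof (cases "C = {}")
    case False
    show ?thesis
      using tendsto_integral_infdist[OF fin(1) sets(1) that False]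
        tendsto_integral_infdist[OF fin(2) sets(2) that False]
      unfolding eq[OF Lip1_infdist] by (rule LIMSEQ_unique)
  qed simp
  have id: "(\<lambda>x. x) \<in> L \<rightarrow>\<^sub>M borel" if "sets L = sets (borel_on X)" for L
    using that by (simp cong: measurable_cong_sets add: measurable_restrict_space1)
  have em: "emeasure (distr L borel (\<lambda>x. x)) B = emeasure L (B \<inter> X)"
    if "sets L = sets (borel_on X)" "space L = X" "B \<in> sets borel" for L B
    using that by (simp add: emeasure_distr id)
  have "distr M borel (\<lambda>x. x) = distr N borel (\<lambda>x. x)"
  proof (rule measure_eqI_generator_eq[where E="Collect closed" and \<Omega>=UNIV and A="\<lambda>_. UNIV"])
    show "Int_stable (Collect closed :: 'a set set)"
      by (auto simp: Int_stable_def)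
    show "emeasure (distr M borel (\<lambda>x. x)) B = emeasure (distr N borel (\<lambda>x. x)) B"
      if "B \<in> Collect closed" for B
      using that closed_eq[of B]
      by (simp add: em sets space M.emeasure_eq_measure N.emeasure_eq_measure)
    show "emeasure (distr M borel (\<lambda>x. x)) UNIV \<noteq> \<infinity>"
      by (simp add: em sets space)
  qed (auto simp: borel_eq_closed)
  moreover obtain B where "B \<in> sets borel" "A = B \<inter> X"
    using A by (auto simp: sets_restrict_space)
  ultimately have "emeasure M A = emeasure N A"
    using em[of M B] em[of N B] sets space by metis
  then show ?thesis by (simp add: measure_def)
qed

text \<open>Equal integrals give equal scalar measures, hence equal quadratic forms of
  \<open>E A\<close> and \<open>F A\<close>. Off the Borel sets extensionality settles
  equality.\<close>

lemma pvm_eqI: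
  fixes X :: "'a::metric_space set" and E F :: "'a set \<Rightarrow> 'h::chilbert_space \<Rightarrow>\<^sub>L 'h"
  assumes X: "compact X" and E: "E \<in> pvms X" and F: "F \<in> pvms X"
    and eq: "\<And>\<phi>. \<phi> \<in> Lip1 X \<Longrightarrow> pvm_integral X E (\<lambda>x. complex_of_real (\<phi> x)) =
      pvm_integral X F (\<lambda>x. complex_of_real (\<phi> x))"
  shows "E = F"
proof (rule PiE_ext)
  show "E \<in> sets (borel_on X) \<rightarrow>\<^sub>E orth_projections" "F \<in> sets (borel_on X) \<rightarrow>\<^sub>E orth_projections"
    using E F by (auto simp: pvms_def)
  fix A assume A: "A \<in> sets (borel_on X)"
  have "measure (scalar_measure X E g) A = measure (scalar_measure X F g) A" for g
  proof (rule measure_eqI_Lip1[OF _ _ _ _ _ A])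
    fix \<phi> :: "'a \<Rightarrow> real" assume "\<phi> \<in> Lip1 X"
    then show "integral\<^sup>L (scalar_measure X E g) \<phi> = integral\<^sup>L (scalar_measure X F g) \<phi>"
      using eq pvm_integral_Lip1[OF X E] pvm_integral_Lip1[OF X F] by metis
  qed (simp_all add: finite_scalar_measure E F)
  then show "E A = F A"
    using pvmsD(1)[OF E A] pvmsD(1)[OF F A] orth_projections_symmetric
    by (intro symmetric_op_eqI) (auto simp: measure_scalar_measure[OF E A] measure_scalar_measure[OF F A])
qed

section \<open>The supremum metric and its bound\<close>

theorem corollary2p6:
  fixes X :: "'a::metric_space set"
    and P :: "('a set \<Rightarrow> 'h::chilbert_space \<Rightarrow>\<^sub>L 'h) set"
    and \<rho> :: "('a set \<Rightarrow> 'h \<Rightarrow>\<^sub>L 'h) \<Rightarrow> ('a set \<Rightarrow> 'h \<Rightarrow>\<^sub>L 'h) \<Rightarrow> real"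
  defines "P \<equiv> pvms X" and "\<rho> \<equiv> pvm_dist X"
  assumes "compact X"
  shows "(\<forall>E\<in>P. \<forall>F\<in>P. bdd_above (pvm_diffs X E F)) \<and>
         Metric_space P \<rho> \<and> Metric_space.mbounded P \<rho> P"
proof -
  define I where "I = (\<lambda>E :: 'a set \<Rightarrow> 'h \<Rightarrow>\<^sub>L 'h. \<lambda>\<phi>. pvm_integral X E (\<lambda>x. complex_of_real (\<phi> x)))"
  have diffs: "pvm_diffs X E F = (\<lambda>\<phi>. norm (I E \<phi> - I F \<phi>)) ` Lip1 X" for E F
    by (simp add: pvm_diffs_def I_def)
  \<comment> \<open>A real supremum over an empty set would be unspecified; nonemptiness also yields
    \<open>0 \<le> \<rho> E F\<close>.\<close>
  have ne: "Lip1 X \<noteq> {}"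
    using Lip1_infdist by blast
  have bdd: "bdd_above (pvm_diffs X E F)" if "E \<in> P" "F \<in> P" for E F
    using pvm_diff_le[OF assms(3)] that unfolding P_def by (intro bdd_aboveI) blast
  have rho: "\<rho> E F = (SUP \<phi>\<in>Lip1 X. norm (I E \<phi> - I F \<phi>))" if "E \<in> P" "F \<in> P" for E F
    using that by (simp add: \<rho>_def P_def pvm_dist_def diffs)
  have upper: "norm (I E \<phi> - I F \<phi>) \<le> \<rho> E F" if "E \<in> P" "F \<in> P" "\<phi> \<in> Lip1 X" for E F \<phi>
    unfolding rho[OF that(1,2)] using bdd[OF that(1,2)] that(3)
    by (intro cSUP_upper) (simp_all add: diffs)
  have least: "\<rho> E F \<le> c" if "E \<in> P" "F \<in> P" "\<And>\<phi>. \<phi> \<in> Lip1 X \<Longrightarrow> norm (I E \<phi> - I F \<phi>) \<le> c" for E F c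
    unfolding rho[OF that(1,2)] using ne that(3) by (intro cSUP_least)
  interpret Metric_space P \<rho>
  proof
    \<comment> \<open>Here \<open>E\<close> and \<open>F\<close> are arbitrary; outside
      \<open>P\<close> the default value 0 of \<open>pvm_dist\<close> applies.\<close>
    show "0 \<le> \<rho> E F" for E F
    proof (cases "E \<in> P \<and> F \<in> P")
      case True
      then show ?thesis
        using upper ne norm_ge_zero order_trans by blast
    qed (auto simp: \<rho>_def P_def pvm_dist_def)
    show "\<rho> E F = \<rho> F E" for E F
      by (simp add: \<rho>_def pvm_dist_def diffs norm_minus_commute conj_commute)
    show "\<rho> E F = 0 \<longleftrightarrow> E = F" if "E \<in> P" "F \<in> P" for E F
    proof
      assume "\<rho> E F = 0"
      then have "I E \<phi> = I F \<phi>" if "\<phi> \<in> Lip1 X" for \<phi>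
        using upper[OF \<open>E \<in> P\<close> \<open>F \<in> P\<close> that] by simp
      then show "E = F"
        using pvm_eqI[OF assms(3)] \<open>E \<in> P\<close> \<open>F \<in> P\<close> unfolding P_def I_def by blast
    next
      assume "E = F"
      then show "\<rho> E F = 0"
        using ne that by (simp add: rho)
    qed
    show "\<rho> E G \<le> \<rho> E F + \<rho> F G" if "E \<in> P" "F \<in> P" "G \<in> P" for E F G
    proof (rule least[OF that(1,3)])
      fix \<phi> :: "'a \<Rightarrow> real" assume "\<phi> \<in> Lip1 X"
      then show "norm (I E \<phi> - I G \<phi>) \<le> \<rho> E F + \<rho> F G"
        using upper[OF that(1,2)] upper[OF that(2,3)]
          norm_triangle_ineq[of "I E \<phi> - I F \<phi>" "I F \<phi> - I G \<phi>"] by fastforce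
    qed
  qed
  \<comment> \<open>The bound depends on \<open>X\<close> only, so it is uniform over all pairs,
    which is what boundedness of the whole space requires.\<close>
  have "\<rho> E F \<le> 2 * (2 * diameter X + 1)" if "E \<in> P" "F \<in> P" for E F
  proof (rule least[OF that])
    fix \<phi> :: "'a \<Rightarrow> real" assume "\<phi> \<in> Lip1 X"
    then show "norm (I E \<phi> - I F \<phi>) \<le> 2 * (2 * diameter X + 1)"
      using that unfolding P_def by (intro pvm_diff_le[OF assms(3), of E F]) (auto simp: diffs)
  qed
  then have "mbounded P"
    unfolding mbounded_alt by blast
  then show ?thesis
    by (intro conjI ballI bdd Metric_space_axioms)
qed

end
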